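(* Let $q$ be a complex number with $0<|q|<1$, let $y$ be a complex number not of the form $\pm q^{-j}$ with $j\ge0$ an integer, and let $a,b$ be nonzero complex numbers such that $yq/a\ne q^{-j}$ and $yq/b\neq q^{-j}$ for all integers $j\ge 0$. If $|yq/(ab)|<1$, then $$\sum_{n=0}^{\infty}\frac{(a;q)_n(b;q)_n}{(yq/a;q)_n(yq/b;q)_n}\left(\frac{y^2}{ab}\right)^nq^{n^2/2+n/2}$$ $$=\frac{(yq;q)_\infty\,(yq/(ab);q)_\infty}{(yq/a;q)_\infty\,(yq/b;q)_\infty}\sum_{n=0}^{\infty}\frac{(-q;q)_n(-y;q)_n(a;q)_n(b;q)_n}{(yq;q)_{2n}}\left(\frac{yq}{ab}\right)^n\sum_{k=0}^{n}\frac{q^{2k}(y/q;q)_{2k}}{(q^2;q^2)_k\,(y^2;q^2)_k}.$$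
   Context: For $|p|<1$: $(x;p)_\infty=\prod_{i=0}^\infty(1-xp^i)$ and, for integers $n\ge 0$, $(x;p)_n=\prod_{i=0}^{n-1}(1-xp^i)$ (empty product equal to $1$). The convention $0^0=1$ is used. *)

theory Defs
  imports "HOL-Analysis.Analysis"
begin

definition qpoch :: "complex \<Rightarrow> complex \<Rightarrow> nat \<Rightarrow> complex" where
  "qpoch x p n = (\<Prod>i<n. 1 - x * p ^ i)"

(* prodinf also assigns the value 0 to a convergent product with finitely many vanishing factors,
   so this is the usual infinite product for every x when |p| < 1. *)
definition qpoch_inf :: "complex \<Rightarrow> complex \<Rightarrow> complex" where
  "qpoch_inf x p = (\<Prod>i. 1 - x * p ^ i)"

(* The exponent n^2/2 + n/2 is always an integer, so the natural number division is exact. *)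
definition lhs_term :: "complex \<Rightarrow> complex \<Rightarrow> complex \<Rightarrow> complex \<Rightarrow> nat \<Rightarrow> complex" where
  "lhs_term q y a b n =
     (qpoch a q n * qpoch b q n) / (qpoch (y * q / a) q n * qpoch (y * q / b) q n)
       * (y\<^sup>2 / (a * b)) ^ n * q ^ ((n\<^sup>2 + n) div 2)"

definition rhs_term :: "complex \<Rightarrow> complex \<Rightarrow> complex \<Rightarrow> complex \<Rightarrow> nat \<Rightarrow> complex" where
  "rhs_term q y a b n =
     (qpoch (- q) q n * qpoch (- y) q n * qpoch a q n * qpoch b q n) / qpoch (y * q) q (2 * n)
       * (y * q / (a * b)) ^ n
       * (\<Sum>k\<le>n. q ^ (2 * k) * qpoch (y / q) q (2 * k)
             / (qpoch (q\<^sup>2) (q\<^sup>2) k * qpoch (y\<^sup>2) (q\<^sup>2) k))"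

end

theory Submission imports Defs begin

text \<open>The identity is Bailey's lemma for the pair with \<open>\<alpha>\<^sub>r = y^r q^(r(r-1)/2)\<close>.
  Bailey's lemma itself is an interchange of summation in an absolutely convergent double series
  whose inner sum is evaluated by the q-Gauss sum; the latter follows by iterating the contiguous
  relation that sends \<open>x\<close> to \<open>x q\<close>. For the given \<open>\<alpha>\<close>, creative telescoping yields a first order
  inhomogeneous recurrence for \<open>\<beta>\<^sub>n\<close>, and summing its inhomogeneous part gives the inner sum
  over \<open>k\<close> on the right-hand side.\<close>

section \<open>Finite q-shifted factorials\<close>

lemma qpoch_0 [simp]: "qpoch x q 0 = 1"
  by (simp add: qpoch_def)

lemma qpoch_Suc: "qpoch x q (Suc n) = qpoch x q n * (1 - x * q ^ n)"
  by (simp add: qpoch_def)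

lemma qpoch_add: "qpoch x q (m + n) = qpoch x q m * qpoch (x * q ^ m) q n"
  by (induction n) (simp_all add: qpoch_Suc power_add mult_ac)

lemma qpoch_Suc_left: "qpoch x q (Suc n) = (1 - x) * qpoch (x * q) q n"
  using qpoch_add[of x q 1 n] by (simp add: qpoch_Suc)

lemma qpoch_square: "qpoch (x\<^sup>2) (q\<^sup>2) n = qpoch x q n * qpoch (- x) q n"
  by (induction n) (simp_all add: qpoch_Suc algebra_simps power2_eq_square power_mult_distrib)

lemma qpoch_nonzero: "(\<And>i. x * q ^ i \<noteq> 1) \<Longrightarrow> qpoch x q n \<noteq> 0"
  by (auto simp: qpoch_def)

section \<open>Infinite products and uniform bounds\<close>

context
  fixes q :: complex
  assumes norm_q: "norm q < 1"
begin

lemma convergent_prod_qpoch: "convergent_prod (\<lambda>i. 1 - x * q ^ i)"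
proof -
  have "summable (\<lambda>i. norm (- (x * q ^ i)))"
    using norm_q by (auto simp: norm_mult norm_power intro!: summable_mult summable_geometric)
  then have "convergent_prod (\<lambda>i. 1 + (- (x * q ^ i)))"
    by (intro abs_convergent_prod_imp_convergent_prod summable_imp_abs_convergent_prod) simp
  then show ?thesis by simp
qed

lemma qpoch_tendsto: "(\<lambda>n. qpoch x q n) \<longlonglongrightarrow> qpoch_inf x q"
  using convergent_prod_LIMSEQ[OF convergent_prod_qpoch[of x]]
  unfolding qpoch_inf_def qpoch_def by (subst (asm) LIMSEQ_lessThan_iff_atMost[symmetric]) simp

lemma qpoch_inf_nonzero: "(\<And>i. x * q ^ i \<noteq> 1) \<Longrightarrow> qpoch_inf x q \<noteq> 0"
  unfolding qpoch_inf_def by (rule prodinf_nonzero[OF convergent_prod_qpoch]) auto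

lemma qpoch_inf_split: "qpoch_inf x q = qpoch x q m * qpoch_inf (x * q ^ m) q"
proof -
  have "(\<lambda>n. qpoch x q (n + m)) \<longlonglongrightarrow> qpoch_inf x q"
    by (rule LIMSEQ_ignore_initial_segment[OF qpoch_tendsto])
  moreover have "(\<lambda>n. qpoch x q (n + m)) \<longlonglongrightarrow> qpoch x q m * qpoch_inf (x * q ^ m) q"
    unfolding add.commute[of _ m] qpoch_add by (intro tendsto_mult_left qpoch_tendsto)
  ultimately show ?thesis by (rule LIMSEQ_unique)
qed

lemma qpoch_bounded: obtains K where "K > 0" "\<And>n. norm (qpoch x q n) \<le> K"
  using convergent_imp_Bseq[OF convergentI[OF qpoch_tendsto[of x]]] by (auto simp: Bseq_def)

text \<open>No factor vanishes, so the infinite product is nonzero; the inverses of the partial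
  products then converge and hence are bounded.\<close>

lemma inverse_qpoch_bounded:
  assumes "\<And>i. x * q ^ i \<noteq> 1"
  obtains K where "K > 0" "\<And>n. norm (inverse (qpoch x q n)) \<le> K"
proof -
  have "(\<lambda>n. inverse (qpoch x q n)) \<longlonglongrightarrow> inverse (qpoch_inf x q)"
    by (intro tendsto_inverse qpoch_tendsto qpoch_inf_nonzero assms)
  then show ?thesis
    using that by (auto simp: Bseq_def dest!: convergent_imp_Bseq[OF convergentI])
qed

lemma power_neq_1: "q * q ^ i \<noteq> 1"
proof
  assume "q * q ^ i = 1"
  then have "norm q ^ Suc i = 1" by (metis norm_one norm_power power_Suc)
  with norm_q show False using power_Suc_less_one[of "norm q" i] by (cases "q = 0") auto
qed

section \<open>The q-Gauss sum\<close>

text \<open>Summand of the basic hypergeometric series 2phi1(A, B; C; q, x) with C = A B x, so that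
  x = C/(A B) is the q-Gauss argument. As C is tied to x, replacing x by x q shifts C as
  well.\<close>

definition phi_term :: "complex \<Rightarrow> complex \<Rightarrow> complex \<Rightarrow> nat \<Rightarrow> complex" where
  "phi_term A B x n =
     qpoch A q n * qpoch B q n / (qpoch q q n * qpoch (A * B * x) q n) * x ^ n"

text \<open>The point is uniformity in \<open>N\<close>: since (A B x q^N; q)_n = (A B x; q)_(N+n) /
  (A B x; q)_N, one constant serves all shifted denominators. The factor |q|^(N n) later removes
  every term with n >= 1 in the limit.\<close>

lemma phi_term_bound:
  assumes c: "\<And>i. A * B * x * q ^ i \<noteq> 1"
  obtains K where "K > 0"
    "\<And>N n. norm (phi_term A B (x * q ^ N) n) \<le> K * norm x ^ n * norm q ^ (N * n)"
proof -
  obtain K1 where K1: "K1 > 0" "\<And>n. norm (qpoch A q n) \<le> K1" using qpoch_bounded by blast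
  obtain K2 where K2: "K2 > 0" "\<And>n. norm (qpoch B q n) \<le> K2" using qpoch_bounded by blast
  obtain K3 where K3: "K3 > 0" "\<And>n. norm (inverse (qpoch q q n)) \<le> K3"
    using inverse_qpoch_bounded power_neq_1 by blast
  obtain K4 where K4: "K4 > 0" "\<And>n. norm (qpoch (A * B * x) q n) \<le> K4"
    using qpoch_bounded by blast
  obtain K5 where K5: "K5 > 0" "\<And>n. norm (inverse (qpoch (A * B * x) q n)) \<le> K5"
    using inverse_qpoch_bounded c by blast
  show ?thesis
  proof (rule that)
    show "K1 * K2 * K3 * K4 * K5 > 0" using K1 K2 K3 K4 K5 by simp
    fix N n
    have "inverse (qpoch (A * B * (x * q ^ N)) q n) =
        qpoch (A * B * x) q N * inverse (qpoch (A * B * x) q (N + n))"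
      using qpoch_nonzero[OF c, of N] by (simp add: qpoch_add mult.assoc)
    then have "phi_term A B (x * q ^ N) n = qpoch A q n * qpoch B q n * inverse (qpoch q q n) *
        qpoch (A * B * x) q N * inverse (qpoch (A * B * x) q (N + n)) * x ^ n * q ^ (N * n)"
      unfolding phi_term_def divide_inverse inverse_mult_distrib
      by (simp add: power_mult_distrib power_mult mult_ac)
    also have "norm \<dots> \<le> K1 * K2 * K3 * K4 * K5 * norm x ^ n * norm q ^ (N * n)"
      unfolding norm_mult norm_power
      by (intro mult_mono K1 K2 K3 K4 K5 mult_nonneg_nonneg order.refl norm_ge_zero zero_le_power
          less_imp_le[OF K1(1)] less_imp_le[OF K2(1)] less_imp_le[OF K3(1)] less_imp_le[OF K4(1)]
          less_imp_le[OF K5(1)])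
    finally show "norm (phi_term A B (x * q ^ N) n)
      \<le> K1 * K2 * K3 * K4 * K5 * norm x ^ n * norm q ^ (N * n)" .
  qed
qed

lemma summable_norm_phi_term:
  assumes "norm x < 1" and c: "\<And>i. A * B * x * q ^ i \<noteq> 1"
  shows "summable (\<lambda>n. norm (phi_term A B x n))"
proof -
  obtain K where K: "\<And>N n. norm (phi_term A B (x * q ^ N) n) \<le> K * norm x ^ n * norm q ^ (N * n)"
    using phi_term_bound[OF c] by blast
  show ?thesis
    by (rule summable_comparison_test'[where N = 0 and g = "\<lambda>n. K * norm x ^ n"])
      (use K[of 0] assms(1) in \<open>auto intro!: summable_mult summable_geometric\<close>)
qed

lemma summable_phi_term:
  "norm x < 1 \<Longrightarrow> (\<And>i. A * B * x * q ^ i \<noteq> 1) \<Longrightarrow> summable (phi_term A B x)"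
  by (rule summable_norm_cancel) (rule summable_norm_phi_term)

text \<open>The two sides of the contiguous relation differ termwise by the forward difference of
  \<open>(A B x - 1) (1 - q^n) t\<^sub>n\<close>, where \<open>t\<^sub>n\<close> is the summand on the left.\<close>

lemma phi_contiguous:
  assumes x: "norm x < 1" and c: "\<And>i. A * B * x * q ^ i \<noteq> 1"
  shows "(1 - A * B * x) * (1 - x) * (\<Sum>n. phi_term A B x n) =
    (1 - A * x) * (1 - B * x) * (\<Sum>n. phi_term A B (x * q) n)"
proof -
  define G where "G n = (A * B * x - 1) * (1 - q ^ n) * phi_term A B x n" for n
  have xq: "norm (x * q) < 1"
    using mult_strict_mono'[OF x norm_q] by (simp add: norm_mult)
  have cq: "A * B * (x * q) * q ^ i \<noteq> 1" for i
    using c[of "Suc i"] by (simp add: mult_ac)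
  have s: "summable (phi_term A B x)" and sq: "summable (phi_term A B (x * q))"
    by (intro summable_phi_term x xq c cq)+
  have step: "(1 - A * B * x) * (1 - x) * phi_term A B x n -
      (1 - A * x) * (1 - B * x) * phi_term A B (x * q) n = G (Suc n) - G n" for n
  proof -
    define Q where "Q = q ^ n"
    define U where "U = phi_term A B x n"
    have nz: "1 - A * B * x * Q \<noteq> 0" "1 - A * B * x \<noteq> 0" "1 - q * Q \<noteq> 0"
      using c[of n] c[of 0] power_neq_1[of n] by (auto simp: Q_def)
    have "qpoch (A * B * x) q n * (1 - A * B * x * Q) =
        (1 - A * B * x) * qpoch (A * B * (x * q)) q n"
      using qpoch_Suc qpoch_Suc_left by (metis Q_def mult.assoc)
    then have "qpoch (A * B * (x * q)) q n =
        qpoch (A * B * x) q n * (1 - A * B * x * Q) / (1 - A * B * x)"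
      using nz by (simp add: field_simps)
    then have 1: "phi_term A B (x * q) n = U * Q * (1 - A * B * x) / (1 - A * B * x * Q)"
      by (simp add: U_def phi_term_def power_mult_distrib Q_def mult_ac)
    have 2: "phi_term A B x (Suc n) =
        U * ((1 - A * Q) * (1 - B * Q) * x) / ((1 - q * Q) * (1 - A * B * x * Q))"
      by (simp add: U_def phi_term_def qpoch_Suc Q_def mult_ac)
    \<comment> \<open>The factor 1 - q^(n+1) in \<open>G\<close> cancels the newest factor of (q;
      q)_(n+1), so 1 - A B x Q is the only denominator left in the identity to check.\<close>
    have 3: "(1 - q ^ Suc n) * phi_term A B x (Suc n) =
        U * ((1 - A * Q) * (1 - B * Q) * x) / (1 - A * B * x * Q)"
      unfolding 2 using nz by (simp add: Q_def)
    have "(1 - A * B * x) * (1 - x) * U -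
        (1 - A * x) * (1 - B * x) * (U * Q * (1 - A * B * x) / (1 - A * B * x * Q)) =
        (A * B * x - 1) * (U * ((1 - A * Q) * (1 - B * Q) * x) / (1 - A * B * x * Q))
        - (A * B * x - 1) * ((1 - Q) * U)"
      using nz(1) by (simp add: divide_simps) (simp add: algebra_simps)
    then show ?thesis
      unfolding G_def mult.assoc[of _ "1 - q ^ Suc n"] 3 1 U_def[symmetric] Q_def[symmetric]
      by (simp add: mult.assoc)
  qed
  \<comment> \<open>Both boundary values of the telescoping sum vanish: the terms of a convergent
    series tend to 0, and \<open>G 0\<close> contains the factor 1 - q^0.\<close>
  have "G \<longlonglongrightarrow> (A * B * x - 1) * (1 - 0) * 0"
    unfolding G_def by (intro tendsto_intros LIMSEQ_power_zero norm_q summable_LIMSEQ_zero s)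
  then have "(\<lambda>n. G (Suc n) - G n) sums (0 - G 0)"
    by (intro telescope_sums) simp
  then have "(\<lambda>n. G (Suc n) - G n) sums 0" by (simp add: G_def)
  moreover have "(\<lambda>n. G (Suc n) - G n) sums ((1 - A * B * x) * (1 - x) * (\<Sum>n. phi_term A B x n)
      - (1 - A * x) * (1 - B * x) * (\<Sum>n. phi_term A B (x * q) n))"
    unfolding step[symmetric] by (intro sums_diff sums_mult summable_sums s sq)
  ultimately show ?thesis using sums_unique2 by fastforce
qed

text \<open>Iterating \<open>phi_contiguous\<close> relates the sum at x to the sum at x q^N through
  finite products. As N grows these products converge, and the sum at x q^N tends to 1 because only
  its term n = 0 survives.\<close>

lemma q_gauss:
  assumes x: "norm x < 1" and c: "\<And>i. A * B * x * q ^ i \<noteq> 1"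
  shows "(\<Sum>n. phi_term A B x n) = qpoch_inf (A * x) q * qpoch_inf (B * x) q /
    (qpoch_inf (A * B * x) q * qpoch_inf x q)"
proof -
  define F where "F N = (\<Sum>n. phi_term A B (x * q ^ N) n)" for N
  have qN: "norm q ^ N \<le> 1" for N using norm_q by (simp add: power_le_one)
  have xN: "norm (x * q ^ N) < 1" for N
    using mult_mono[OF order.refl qN[of N], of "norm x"] x by (simp add: norm_mult norm_power)
  have cN: "A * B * (x * q ^ N) * q ^ i \<noteq> 1" for N i
    using c[of "N + i"] by (simp add: mult_ac power_add)
  have rec: "F 0 * (qpoch (A * B * x) q N * qpoch x q N) =
      qpoch (A * x) q N * qpoch (B * x) q N * F N" for N
  proof (induction N)
    case (Suc N)
    have "F 0 * (qpoch (A * B * x) q (Suc N) * qpoch x q (Suc N)) =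
      qpoch (A * x) q N * qpoch (B * x) q N *
        ((1 - A * B * (x * q ^ N)) * (1 - x * q ^ N) * F N)"
      unfolding qpoch_Suc using Suc by (simp add: mult_ac)
    also have "(1 - A * B * (x * q ^ N)) * (1 - x * q ^ N) * F N =
      (1 - A * (x * q ^ N)) * (1 - B * (x * q ^ N)) * F (Suc N)"
      unfolding F_def phi_contiguous[OF xN cN] by (simp add: mult_ac)
    finally show ?case by (simp add: qpoch_Suc mult_ac)
  qed simp
  obtain K where K: "K > 0"
    "\<And>N n. norm (phi_term A B (x * q ^ N) n) \<le> K * norm x ^ n * norm q ^ (N * n)"
    using phi_term_bound[OF c] by blast
  have "norm (F N - 1) \<le> norm q ^ N * (K * (\<Sum>n. norm x ^ n))" for N
  proof -
    have s: "summable (phi_term A B (x * q ^ N))"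
      by (intro summable_phi_term xN cN)
    \<comment> \<open>One factor |q|^N is split off |q|^(N(n+1)) to give decay in N; the leftover
      \<open>norm x * norm q ^ (N * n)\<close> is at most 1.\<close>
    have b: "norm (phi_term A B (x * q ^ N) (Suc n)) \<le> norm q ^ N * (K * norm x ^ n)" for n
    proof -
      have "norm (phi_term A B (x * q ^ N) (Suc n)) \<le> K * norm x ^ Suc n * norm q ^ (N * Suc n)"
        by (rule K)
      also have "\<dots> = K * norm x ^ n * norm q ^ N * (norm x * norm q ^ (N * n))"
        by (simp add: power_add mult_ac)
      also have "\<dots> \<le> K * norm x ^ n * norm q ^ N * 1"
        using K(1) x qN[of "N * n"] by (intro mult_left_mono mult_le_one) auto
      finally show ?thesis by (simp add: mult_ac)
    qed
    have "F N - 1 = (\<Sum>n. phi_term A B (x * q ^ N) (Suc n))"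
      unfolding F_def suminf_split_head[OF s] by (simp add: phi_term_def)
    also have "norm \<dots> \<le> (\<Sum>n. norm q ^ N * (K * norm x ^ n))"
      using x by (intro norm_suminf_le b summable_mult summable_geometric) auto
    also have "\<dots> = norm q ^ N * (K * (\<Sum>n. norm x ^ n))"
      using x by (simp add: suminf_mult summable_mult summable_geometric)
    finally show ?thesis .
  qed
  moreover have "(\<lambda>N. norm q ^ N * (K * (\<Sum>n. norm x ^ n))) \<longlonglongrightarrow> 0"
    using norm_q by (intro tendsto_mult_left_zero LIMSEQ_power_zero) simp
  ultimately have "(\<lambda>N. F N - 1) \<longlonglongrightarrow> 0"
    by (rule Lim_null_comparison[OF always_eventually[OF allI]])
  then have "F \<longlonglongrightarrow> 1" by (simp add: LIM_zero_iff)
  then have "(\<lambda>N. qpoch (A * x) q N * qpoch (B * x) q N * F N) \<longlonglongrightarrow>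
      qpoch_inf (A * x) q * qpoch_inf (B * x) q * 1"
    by (intro tendsto_mult qpoch_tendsto)
  moreover have "(\<lambda>N. F 0 * (qpoch (A * B * x) q N * qpoch x q N)) \<longlonglongrightarrow>
      F 0 * (qpoch_inf (A * B * x) q * qpoch_inf x q)"
    by (intro tendsto_mult qpoch_tendsto tendsto_const)
  ultimately have "F 0 * (qpoch_inf (A * B * x) q * qpoch_inf x q) =
      qpoch_inf (A * x) q * qpoch_inf (B * x) q"
    unfolding rec using LIMSEQ_unique by fastforce
  moreover have "x * q ^ i \<noteq> 1" for i using xN[of i] by auto
  then have "qpoch_inf (A * B * x) q \<noteq> 0" "qpoch_inf x q \<noteq> 0"
    by (intro qpoch_inf_nonzero c; simp)+
  ultimately show ?thesis by (simp add: F_def field_simps)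
qed

end

section \<open>Interchange of summation in a double series\<close>

text \<open>Domination by \<open>u r * v m\<close> makes the family absolutely summable over all
  pairs, so summing along rows and along diagonals n = r + m gives the same total.\<close>

lemma triangular_suminf:
  fixes h :: "nat \<Rightarrow> nat \<Rightarrow> complex"
  assumes "summable u" "summable v" and bound: "\<And>r m. norm (h r m) \<le> u r * v m"
    and u: "\<And>r. u r \<ge> 0" and v: "\<And>m. v m \<ge> 0"
  shows "summable (\<lambda>n. \<Sum>r\<le>n. h r (n - r))" "summable (\<lambda>r. \<Sum>m. h r m)"
    "(\<Sum>n. \<Sum>r\<le>n. h r (n - r)) = (\<Sum>r. \<Sum>m. h r m)"
proof -
  have uv: "u summable_on UNIV" "v summable_on UNIV"
    using assms by (auto simp: summable_on_UNIV_nonneg_real_iff)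
  have "(\<lambda>(r, m). u r * v m) summable_on UNIV \<times> UNIV"
  proof (rule summable_on_SigmaI)
    show "((\<lambda>m. case (r, m) of (r, m) \<Rightarrow> u r * v m) has_sum u r * infsum v UNIV) UNIV" for r
      using uv by (auto intro!: has_sum_cmult_right)
    show "(\<lambda>r. u r * infsum v UNIV) summable_on UNIV"
      by (intro summable_on_cmult_left uv)
  qed (use u v in auto)
  then have "(\<lambda>z. norm (case z of (r, m) \<Rightarrow> h r m)) summable_on UNIV \<times> UNIV"
    by (rule Infinite_Sum.abs_summable_on_comparison_test') (use bound in auto)
  then obtain S where S: "((\<lambda>(r, m). h r m) has_sum S) (UNIV \<times> UNIV)"
    using abs_summable_summable summable_on_def by blast
  have "((\<lambda>m. h r m) has_sum (\<Sum>m. h r m)) UNIV" for r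
  proof -
    have "summable (\<lambda>m. norm (h r m))"
      by (rule summable_comparison_test'[where N = 0 and g = "\<lambda>m. u r * v m"])
        (use assms in \<open>auto intro: summable_mult\<close>)
    then show ?thesis
      using norm_summable_imp_has_sum[OF _ summable_sums[OF summable_norm_cancel]] by blast
  qed
  then have "((\<lambda>r. \<Sum>m. h r m) has_sum S) UNIV"
    by (intro has_sum_SigmaD[OF S]) auto
  then have 1: "(\<lambda>r. \<Sum>m. h r m) sums S" by (rule has_sum_imp_sums)
  \<comment> \<open>The map (r, m) to (r + m, r) carries all pairs bijectively onto the triangle r
    \<le> n.\<close>
  have "((\<lambda>(n, r). h r (n - r)) has_sum S) (Sigma UNIV (\<lambda>n. {..n}))"
    using S
    by (subst has_sum_reindex_bij_witness[where T = "UNIV \<times> UNIV"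
        and i = "\<lambda>(r, m). (r + m, r)" and j = "\<lambda>(n, r). (r, n - r)"]) auto
  then have "((\<lambda>n. \<Sum>r\<le>n. h r (n - r)) has_sum S) UNIV"
    by (rule has_sum_SigmaD) (auto intro: has_sum_finiteI)
  then have 2: "(\<lambda>n. \<Sum>r\<le>n. h r (n - r)) sums S" by (rule has_sum_imp_sums)
  show "summable (\<lambda>n. \<Sum>r\<le>n. h r (n - r))" "summable (\<lambda>r. \<Sum>m. h r m)"
    "(\<Sum>n. \<Sum>r\<le>n. h r (n - r)) = (\<Sum>r. \<Sum>m. h r m)"
    using 1 2 by (auto simp: sums_iff)
qed

section \<open>Bailey's lemma\<close>

text \<open>Together with \<alpha>, this sequence forms a Bailey pair relative to y.\<close>

definition bailey_beta :: "complex \<Rightarrow> complex \<Rightarrow> (nat \<Rightarrow> complex) \<Rightarrow> nat \<Rightarrow> complex" where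
  "bailey_beta y q \<alpha> n = (\<Sum>r\<le>n. \<alpha> r / (qpoch q q (n - r) * qpoch (y * q) q (n + r)))"

text \<open>In \<open>bailey_lemma\<close>, \<open>a\<close> and \<open>b\<close> are the parameters \<open>\<rho>\<^sub>1\<close> and \<open>\<rho>\<^sub>2\<close>
  of the usual formulation, and the condition \<open>y q = a b x\<close> replaces
  \<open>x = y q / (\<rho>\<^sub>1 \<rho>\<^sub>2)\<close>, so that \<open>y q / a = b x\<close> and \<open>y q / b = a x\<close>.\<close>

lemma bailey_lemma:
  assumes q: "norm q < 1" and x: "norm x < 1" and abx: "a * b * x = y * q"
    and nz: "\<And>i. y * q * q ^ i \<noteq> 1" "\<And>i. a * x * q ^ i \<noteq> 1" "\<And>i. b * x * q ^ i \<noteq> 1"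
    and \<alpha>: "summable (\<lambda>r. norm (\<alpha> r * x ^ r))"
  defines "L r \<equiv> qpoch a q r * qpoch b q r / (qpoch (b * x) q r * qpoch (a * x) q r) * x ^ r * \<alpha> r"
    and "R n \<equiv> qpoch a q n * qpoch b q n * x ^ n * bailey_beta y q \<alpha> n"
  shows "summable L" "summable R"
    "(\<Sum>r. L r) = qpoch_inf (y * q) q * qpoch_inf x q /
       (qpoch_inf (b * x) q * qpoch_inf (a * x) q) * (\<Sum>n. R n)"
proof -
  \<comment> \<open>These are the terms of \<open>R n\<close> after inserting
    \<open>bailey_beta\<close> and setting n = r + m, so that n - r = m and n + r = 2 r + m.\<close>
  define h where "h r m = qpoch a q (r + m) * qpoch b q (r + m) * x ^ (r + m) * \<alpha> r /
    (qpoch q q m * qpoch (y * q) q (2 * r + m))" for r m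
  obtain K1 where K1: "K1 > 0" "\<And>n. norm (qpoch a q n) \<le> K1" using qpoch_bounded[OF q] by blast
  obtain K2 where K2: "K2 > 0" "\<And>n. norm (qpoch b q n) \<le> K2" using qpoch_bounded[OF q] by blast
  obtain K3 where K3: "K3 > 0" "\<And>n. norm (inverse (qpoch q q n)) \<le> K3"
    using inverse_qpoch_bounded[OF q power_neq_1[OF q]] by blast
  obtain K4 where K4: "K4 > 0" "\<And>n. norm (inverse (qpoch (y * q) q n)) \<le> K4"
    using inverse_qpoch_bounded[OF q nz(1)] by blast
  define u where "u r = K1 * K2 * K3 * K4 * norm (\<alpha> r * x ^ r)" for r
  have bound: "norm (h r m) \<le> u r * norm x ^ m" for r m
  proof -
    have "h r m = qpoch a q (r + m) * qpoch b q (r + m) * inverse (qpoch q q m) *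
        inverse (qpoch (y * q) q (2 * r + m)) * (\<alpha> r * x ^ r) * x ^ m"
      by (simp add: h_def divide_inverse power_add mult_ac)
    \<comment> \<open>The norm of \<open>\<alpha> r * x ^ r\<close> is kept whole, since its
      summability is the hypothesis.\<close>
    also have "norm \<dots> \<le> K1 * K2 * K3 * K4 * norm (\<alpha> r * x ^ r) * norm x ^ m"
      unfolding norm_mult[of _ "x ^ m"] norm_mult[of _ "\<alpha> r * x ^ r"] norm_power
        norm_mult[of _ "inverse _"] norm_mult[of "qpoch _ _ _"]
      by (intro mult_mono K1 K2 K3 K4 mult_nonneg_nonneg order.refl norm_ge_zero zero_le_power
          less_imp_le[OF K1(1)] less_imp_le[OF K2(1)] less_imp_le[OF K3(1)] less_imp_le[OF K4(1)])
    finally show ?thesis by (simp add: u_def)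
  qed
  have su: "summable u" unfolding u_def by (intro summable_mult \<alpha>)
  have sv: "summable (\<lambda>m. norm x ^ m)" using x by (simp add: summable_geometric)
  have u0: "u r \<ge> 0" for r using K1 K2 K3 K4 by (simp add: u_def)
  note tri = triangular_suminf[OF su sv bound u0 zero_le_power[OF norm_ge_zero]]
  define P where "P = qpoch_inf (a * x) q * qpoch_inf (b * x) q /
    (qpoch_inf (y * q) q * qpoch_inf x q)"
  have x1: "x * q ^ i \<noteq> 1" for i
  proof -
    have "norm q ^ i \<le> 1" using q by (simp add: power_le_one)
    then have "norm (x * q ^ i) < 1"
      using mult_mono[OF order.refl, of "norm q ^ i" 1 "norm x"] x
      by (simp add: norm_mult norm_power)
    then show ?thesis by auto
  qed
  have inf_nz: "qpoch_inf (a * x) q \<noteq> 0" "qpoch_inf (b * x) q \<noteq> 0"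
    "qpoch_inf (y * q) q \<noteq> 0" "qpoch_inf x q \<noteq> 0"
    by (intro qpoch_inf_nonzero q nz x1)+
  \<comment> \<open>This is the q-Gauss sum with A = a q^r and B = b q^r, whose denominator
    parameter A B x is y q^(2r+1). Splitting the infinite products leaves the factor
    \<open>P\<close>, independent of r.\<close>
  have inner: "(\<Sum>m. h r m) = P * L r" for r
  proof -
    have AB: "a * q ^ r * (b * q ^ r) * x = y * q * q ^ (2 * r)"
      unfolding abx[symmetric] power_even_eq by (simp add: power2_eq_square mult_ac)
    have AB1: "a * q ^ r * (b * q ^ r) * x * q ^ i \<noteq> 1" for i
      unfolding AB using nz(1)[of "2 * r + i"] by (simp add: power_add mult_ac)
    have "h r m = qpoch a q r * qpoch b q r * x ^ r * \<alpha> r / qpoch (y * q) q (2 * r) *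
        phi_term q (a * q ^ r) (b * q ^ r) x m" for m
      unfolding h_def phi_term_def[OF q] AB by (simp add: qpoch_add power_add mult_ac)
    then have "(\<Sum>m. h r m) = qpoch a q r * qpoch b q r * x ^ r * \<alpha> r / qpoch (y * q) q (2 * r) *
        (\<Sum>m. phi_term q (a * q ^ r) (b * q ^ r) x m)"
      by (simp only: suminf_mult[OF summable_phi_term[OF q x AB1]])
    also have "(\<Sum>m. phi_term q (a * q ^ r) (b * q ^ r) x m) =
        qpoch_inf (a * x * q ^ r) q * qpoch_inf (b * x * q ^ r) q /
        (qpoch_inf (y * q * q ^ (2 * r)) q * qpoch_inf x q)"
      unfolding q_gauss[OF q x AB1] AB by (simp add: mult_ac)
    finally show ?thesis
      unfolding P_def L_def qpoch_inf_split[OF q, of "a * x" r] qpoch_inf_split[OF q, of "b * x" r]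
        qpoch_inf_split[OF q, of "y * q" "2 * r"]
      using qpoch_nonzero[OF nz(2), of r] qpoch_nonzero[OF nz(3), of r] by (simp add: mult_ac)
  qed
  have outer: "(\<Sum>r\<le>n. h r (n - r)) = R n" for n
    unfolding R_def bailey_beta_def sum_distrib_left
    by (intro sum.cong refl) (simp add: h_def mult_ac mult_2 add.commute)
  have "P \<noteq> 0" using inf_nz by (simp add: P_def)
  show R: "summable R" using tri(1) unfolding outer .
  have "summable (\<lambda>r. P * L r)" using tri(2) unfolding inner .
  then show L: "summable L" using \<open>P \<noteq> 0\<close> by (simp add: summable_cmult_iff)
  have "(\<Sum>n. R n) = P * (\<Sum>r. L r)"
    using tri(3) unfolding outer inner suminf_mult[OF L] .
  then show "(\<Sum>r. L r) = qpoch_inf (y * q) q * qpoch_inf x q /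
       (qpoch_inf (b * x) q * qpoch_inf (a * x) q) * (\<Sum>n. R n)"
    using inf_nz by (simp add: P_def field_simps)
qed

section \<open>The Bailey pair of the identity\<close>

text \<open>The binomial coefficient gives r(r-1)/2 as a natural number; by
  \<open>choose_two_Suc\<close>, term r + 1 is y q^r times term r.\<close>

abbreviation alpha :: "complex \<Rightarrow> complex \<Rightarrow> nat \<Rightarrow> complex" where
  "alpha y q r \<equiv> y ^ r * q ^ (r choose 2)"

lemma choose_two_Suc: "Suc r choose 2 = (r choose 2) + r"
  by (simp add: numeral_2_eq_2)

lemma zero_choose_two [simp]: "0 choose 2 = 0"
  by (simp add: numeral_2_eq_2)

text \<open>Bridge to the exponent in \<open>lhs_term\<close>: a further factor q^r raises the
  exponent of \<open>alpha\<close> to (r^2 + r)/2.\<close>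

lemma choose_two_Suc_eq: "(r choose 2) + r = (r\<^sup>2 + r) div 2"
  using choose_two_Suc[of r] choose_two[of "Suc r"] by (simp add: power2_eq_square add.commute)

text \<open>The ratio test works for every x and y, because the factor y x q^r between consecutive
  terms tends to 0.\<close>

lemma summable_alpha:
  assumes q: "norm q < 1"
  shows "summable (\<lambda>r. norm (alpha y q r * x ^ r))"
proof -
  have "(\<lambda>r. norm (y * x) * norm q ^ r) \<longlonglongrightarrow> 0"
    using q by (intro tendsto_mult_right_zero LIMSEQ_power_zero) simp
  then have "eventually (\<lambda>r. norm (y * x) * norm q ^ r < 1 / 2) sequentially"
    by (rule order_tendstoD) simp
  then obtain N where N: "\<And>r. r \<ge> N \<Longrightarrow> norm (y * x) * norm q ^ r < 1 / 2"
    by (auto simp: eventually_sequentially)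
  show ?thesis
  proof (rule summable_ratio_test[where c = "1 / 2" and N = N])
    fix r assume "r \<ge> N"
    have "norm (alpha y q (Suc r) * x ^ Suc r) =
        norm (y * x) * norm q ^ r * norm (alpha y q r * x ^ r)"
      unfolding choose_two_Suc by (simp add: norm_mult norm_power power_add mult_ac)
    also have "\<dots> \<le> 1 / 2 * norm (alpha y q r * x ^ r)"
      using N[OF \<open>r \<ge> N\<close>] by (intro mult_right_mono) auto
    finally show "norm (norm (alpha y q (Suc r) * x ^ Suc r)) \<le>
        1 / 2 * norm (norm (alpha y q r * x ^ r))" by simp
  qed simp
qed

text \<open>Creative telescoping in \<open>r\<close>; the certificate \<open>G\<close> comes from Zeilberger's method.\<close>

lemma bailey_beta_alpha_Suc:
  assumes q: "norm q < 1" and nz: "\<And>i. y * q * q ^ i \<noteq> 1"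
  shows "(1 - y * q ^ (2 * n + 1)) * (1 - y * q ^ (2 * n + 2)) * bailey_beta y q (alpha y q) (Suc n) =
    (1 + q ^ Suc n) * (1 + y * q ^ n) * bailey_beta y q (alpha y q) n
    + q ^ (2 * n + 1) * (q - y) / (qpoch q q (Suc n) * qpoch (y * q) q n)"
proof -
  define F where "F n r = alpha y q r / (qpoch q q (n - r) * qpoch (y * q) q (n + r))" for n r
  define P where "P r = q ^ Suc n * (1 + y * q ^ n) - q ^ (Suc n - r) * (1 + q ^ Suc n)" for r
  define G where "G r = P r * alpha y q r / (qpoch q q (Suc n - r) * qpoch (y * q) q (n + r))" for r
  define c where "c = (1 - y * q ^ (2 * n + 1)) * (1 - y * q ^ (2 * n + 2))"
  \<comment> \<open>For r = n + 1, truncated subtraction yields (q; q)_0 in \<open>F n r\<close>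
    instead of the conventional 1/(q; q)_(-1) = 0. Telescoping therefore stops at r = n, and the top
    term is treated separately.\<close>
  have step: "c * F (Suc n) r - (1 + q ^ Suc n) * (1 + y * q ^ n) * F n r = G (Suc r) - G r"
    if "r \<le> n" for r
  proof -
    \<comment> \<open>Writing n = r + s removes the subtractions. Once \<open>W\<close> collects all
      denominators, the claim is a polynomial identity in q, y, Q = q^r and S = q^s.\<close>
    obtain s where n: "n = r + s" using \<open>r \<le> n\<close> le_Suc_ex by blast
    define Q where "Q = q ^ r"
    define S where "S = q ^ s"
    define E where "E = qpoch (y * q) q (n + r)"
    define D where "D = qpoch q q s"
    have e1: "1 - y * q * Q * Q * S \<noteq> 0"
      using nz[of "n + r"] by (auto simp: n Q_def S_def power_add mult_ac)
    have d1: "1 - q * S \<noteq> 0" using power_neq_1[OF q, of s] by (auto simp: S_def)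
    have E0: "E \<noteq> 0" unfolding E_def by (rule qpoch_nonzero[OF nz])
    have D0: "D \<noteq> 0" unfolding D_def by (rule qpoch_nonzero[OF power_neq_1[OF q]])
    have F1: "F (Suc n) r = alpha y q r / (D * (1 - q * S) * (E * (1 - y * q * Q * Q * S)))"
      by (simp add: F_def n D_def E_def Suc_diff_le qpoch_Suc S_def Q_def power_add mult_ac)
    have F2: "F n r = alpha y q r / (D * E)"
      by (simp add: F_def n D_def E_def)
    have G1: "G (Suc r) = (q * Q * S * (1 + y * Q * S) - S * (1 + q * Q * S)) *
        (alpha y q r * y * Q) / (D * (E * (1 - y * q * Q * Q * S)))"
      unfolding G_def P_def choose_two_Suc
      by (simp add: n D_def E_def qpoch_Suc S_def Q_def power_add mult_ac)
    have G2: "G r = (q * Q * S * (1 + y * Q * S) - q * S * (1 + q * Q * S)) *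
        alpha y q r / (D * (1 - q * S) * E)"
      unfolding G_def P_def
      by (simp add: n D_def E_def Suc_diff_le qpoch_Suc S_def Q_def power_add mult_ac)
    have c: "c = (1 - y * q * (Q * S) * (Q * S)) * (1 - y * q * q * (Q * S) * (Q * S))"
      by (simp add: c_def n Q_def S_def power_add power_mult power2_eq_square power_mult_distrib mult_ac)
    have N: "q ^ Suc n = q * Q * S" "q ^ n = Q * S"
      by (simp_all add: n Q_def S_def power_add mult_ac)
    define W where "W = alpha y q r / (D * (1 - q * S) * (E * (1 - y * q * Q * Q * S)))"
    have W: "F (Suc n) r = W" "F n r = W * ((1 - q * S) * (1 - y * q * Q * Q * S))"
      "G (Suc r) = W * ((q * Q * S * (1 + y * Q * S) - S * (1 + q * Q * S)) * (y * Q) * (1 - q * S))"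
      "G r = W * ((q * Q * S * (1 + y * Q * S) - q * S * (1 + q * Q * S)) * (1 - y * q * Q * Q * S))"
      unfolding F1 F2 G1 G2 W_def using e1 d1 by (simp_all add: mult_ac)
    show ?thesis unfolding W c N by algebra
  qed
  have "c * bailey_beta y q (alpha y q) (Suc n) =
      c * (\<Sum>r\<le>n. F (Suc n) r) + c * F (Suc n) (Suc n)"
    by (simp add: bailey_beta_def F_def distrib_left)
  \<comment> \<open>At r = n + 1, \<open>P r\<close> collapses to y q^(2n+1) - 1, while 1 - y
    q^(2n+2) in \<open>c\<close> cancels the last factor of (y q; q)_(2n+2). The top term thus
    cancels the upper boundary term of the telescoped sum.\<close>
  also have "c * F (Suc n) (Suc n) = - G (Suc n)"
  proof -
    have "1 - y * q * q ^ (2 * n + 1) \<noteq> 0" using nz[of "2 * n + 1"] by simp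
    then have c0: "1 - y * (q * (q * q ^ (2 * n))) \<noteq> 0" by (simp add: mult_ac)
    have "2 * n + 2 = Suc (Suc (2 * n))" by simp
    then have F: "F (Suc n) (Suc n) = alpha y q (Suc n) /
        (qpoch (y * q) q (2 * n + 1) * (1 - y * (q * (q * q ^ (2 * n)))))"
      by (simp add: F_def qpoch_Suc mult_2 mult_2_right mult_ac)
    have "- G (Suc n) = (1 - y * q ^ (2 * n + 1)) * alpha y q (Suc n) / qpoch (y * q) q (2 * n + 1)"
      unfolding G_def P_def minus_divide_left by (simp add: mult_2 mult_2_right power_add algebra_simps)
    then show ?thesis unfolding F c_def using c0 by (simp add: mult_ac)
  qed
  also have "c * (\<Sum>r\<le>n. F (Suc n) r) =
      (\<Sum>r\<le>n. c * F (Suc n) r - (1 + q ^ Suc n) * (1 + y * q ^ n) * F n r)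
      + (1 + q ^ Suc n) * (1 + y * q ^ n) * bailey_beta y q (alpha y q) n"
    by (simp add: bailey_beta_def F_def sum_subtractf sum_distrib_left)
  also have "(\<Sum>r\<le>n. c * F (Suc n) r - (1 + q ^ Suc n) * (1 + y * q ^ n) * F n r) =
      (\<Sum>r\<le>n. G (Suc r) - G r)"
    by (intro sum.cong refl step) simp
  also have "\<dots> = G (Suc n) - G 0"
    using sum_telescope[of "\<lambda>r. - G r" n] by simp
  finally have "c * bailey_beta y q (alpha y q) (Suc n) =
      (1 + q ^ Suc n) * (1 + y * q ^ n) * bailey_beta y q (alpha y q) n + - G 0"
    by simp
  \<comment> \<open>Since \<open>P 0\<close> is q^(2n+1) (y - q), the lower boundary term is the
    inhomogeneous part of the recurrence.\<close>
  moreover have "- G 0 = q ^ (2 * n + 1) * (q - y) / (qpoch q q (Suc n) * qpoch (y * q) q n)"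
    unfolding minus_divide_left G_def P_def
    by (simp add: mult_2 mult_2_right power_add algebra_simps)
  ultimately show ?thesis by (simp only: c_def)
qed

text \<open>The prefactor of the sum solves the homogeneous part of the recurrence in
  \<open>bailey_beta_alpha_Suc\<close>; relative to it, the inhomogeneous part contributes exactly
  the summand k = n + 1.\<close>

lemma bailey_beta_alpha:
  assumes q: "norm q < 1" "q \<noteq> 0"
    and nz: "\<And>i. y * q ^ i \<noteq> 1" "\<And>i. y * q ^ i \<noteq> - 1"
  shows "bailey_beta y q (alpha y q) n =
    qpoch (- q) q n * qpoch (- y) q n / qpoch (y * q) q (2 * n) *
    (\<Sum>k\<le>n. q ^ (2 * k) * qpoch (y / q) q (2 * k)
             / (qpoch (q\<^sup>2) (q\<^sup>2) k * qpoch (y\<^sup>2) (q\<^sup>2) k))"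
proof (induction n)
  case 0
  show ?case by (simp add: bailey_beta_def)
next
  case (Suc n)
  have yq: "y * q * q ^ i \<noteq> 1" for i using nz(1)[of "Suc i"] by (simp add: mult_ac)
  define S where "S n = (\<Sum>k\<le>n. q ^ (2 * k) * qpoch (y / q) q (2 * k)
             / (qpoch (q\<^sup>2) (q\<^sup>2) k * qpoch (y\<^sup>2) (q\<^sup>2) k))" for n
  define c where "c = (1 - y * q ^ (2 * n + 1)) * (1 - y * q ^ (2 * n + 2))"
  \<comment> \<open>\<open>T\<close> is \<open>c\<close> times the prefactor at n + 1, so the goal
    amounts to \<open>c\<close> times \<beta> at n + 1 being \<open>T * S (Suc n)\<close>.\<close>
  define T where "T = qpoch (- q) q (Suc n) * qpoch (- y) q (Suc n) / qpoch (y * q) q (2 * n)"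
  have c0: "c \<noteq> 0" using nz(1)[of "2 * n + 1"] nz(1)[of "2 * n + 2"] by (simp add: c_def)
  have E: "qpoch (y * q) q (2 * Suc n) = c * qpoch (y * q) q (2 * n)"
    by (simp add: qpoch_Suc c_def mult_ac)
  have E0: "qpoch (y * q) q (2 * n) \<noteq> 0" by (rule qpoch_nonzero[OF yq])
  have "- q * q ^ i \<noteq> 1" for i
  proof
    assume "- q * q ^ i = 1"
    then have "norm (q * q ^ i) = 1" by (metis minus_mult_left norm_minus_cancel norm_one)
    then have "norm q ^ Suc i = 1" by (simp add: norm_mult norm_power)
    with q show False using power_Suc_less_one[of "norm q" i] by auto
  qed
  then have mq: "qpoch (- q) q (Suc n) \<noteq> 0" by (rule qpoch_nonzero)
  have "- y * q ^ i \<noteq> 1" for i using nz(2)[of i] by (metis minus_equation_iff minus_mult_left)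
  then have my: "qpoch (- y) q (Suc n) \<noteq> 0" by (rule qpoch_nonzero)
  have y1: "1 - y \<noteq> 0" using nz(1)[of 0] by simp
  \<comment> \<open>Removing two leading factors exposes (y q; q)_(2n), which cancels the
    denominator of \<open>T\<close>; the factor 1 - y/q supplies q - y.\<close>
  have top: "qpoch (y / q) q (2 * Suc n) = (1 - y / q) * (1 - y) * qpoch (y * q) q (2 * n)"
    using q by (simp add: qpoch_Suc_left mult.assoc)
  have bot: "qpoch (y\<^sup>2) (q\<^sup>2) (Suc n) = (1 - y) * qpoch (y * q) q n * qpoch (- y) q (Suc n)"
    unfolding qpoch_square qpoch_Suc_left[of y] ..
  have last: "T * (q ^ (2 * Suc n) * qpoch (y / q) q (2 * Suc n)
      / (qpoch (q\<^sup>2) (q\<^sup>2) (Suc n) * qpoch (y\<^sup>2) (q\<^sup>2) (Suc n))) =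
      q ^ (2 * n + 1) * (q - y) / (qpoch q q (Suc n) * qpoch (y * q) q n)"
  proof -
    have "q ^ (2 * Suc n) * (1 - y / q) = q ^ (2 * n + 1) * (q - y)"
      using q by (simp add: field_simps)
    then have num: "q ^ (2 * Suc n) * qpoch (y / q) q (2 * Suc n) =
        q ^ (2 * n + 1) * (q - y) * ((1 - y) * qpoch (y * q) q (2 * n))"
      unfolding top by (metis mult.assoc)
    then show ?thesis
      unfolding num T_def bot qpoch_square[of q] using E0 mq my y1 by simp
  qed
  have "c * bailey_beta y q (alpha y q) (Suc n) = T * S (Suc n)"
    unfolding c_def bailey_beta_alpha_Suc[OF q(1) yq] Suc S_def sum.atMost_Suc distrib_left[of T] last
    by (simp add: T_def qpoch_Suc mult_ac)
  then have "bailey_beta y q (alpha y q) (Suc n) = T * S (Suc n) / c"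
    using c0 by (simp add: field_simps)
  then show ?case unfolding E T_def S_def by (simp only: times_divide_eq_left divide_divide_eq_left mult_ac)
qed

section \<open>The transformation formula\<close>

theorem theorem1p4:
  fixes q y a b :: complex
  assumes "0 < norm q" and "norm q < 1"
    and "\<And>j::nat. y \<noteq> q powi (- int j) \<and> y \<noteq> - (q powi (- int j))"
    and "a \<noteq> 0" and "b \<noteq> 0"
    and "\<And>j::nat. y * q / a \<noteq> q powi (- int j)"
    and "\<And>j::nat. y * q / b \<noteq> q powi (- int j)"
    and "norm (y * q / (a * b)) < 1"
  shows "summable (lhs_term q y a b) \<and> summable (rhs_term q y a b) \<and>
    (\<Sum>n. lhs_term q y a b n) =
      (qpoch_inf (y * q) q * qpoch_inf (y * q / (a * b)) q)
        / (qpoch_inf (y * q / a) q * qpoch_inf (y * q / b) q)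
      * (\<Sum>n. rhs_term q y a b n)"
proof -
  define x where "x = y * q / (a * b)"
  have q0: "q \<noteq> 0" using assms(1) by auto
  \<comment> \<open>This turns the excluded values q^(-j) into conditions on z q^j, the form in
    which the factors of the products appear.\<close>
  have powi: "z * q ^ j = w \<longleftrightarrow> z = w * q powi (- int j)" for z w j
    using q0 by (auto simp: power_int_minus field_simps)
  have x: "norm x < 1" "a * b * x = y * q" "b * x = y * q / a" "a * x = y * q / b"
    using assms by (simp_all add: x_def)
  have y: "y * q ^ i \<noteq> 1" "y * q ^ i \<noteq> - 1" for i
    using assms(3)[of i] by (simp_all add: powi)
  have yq: "y * q * q ^ i \<noteq> 1" for i
    using y(1)[of "Suc i"] by (simp add: mult.assoc)
  have ab: "a * x * q ^ i \<noteq> 1" "b * x * q ^ i \<noteq> 1" for i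
    using assms(6,7)[of i] unfolding x(3,4) by (simp_all only: powi mult_1_left not_False_eq_True)
  have L: "lhs_term q y a b = (\<lambda>r. qpoch a q r * qpoch b q r /
      (qpoch (b * x) q r * qpoch (a * x) q r) * x ^ r * alpha y q r)"
  proof
    fix r
    \<comment> \<open>Here x^r y^r = (y^2/(a b))^r q^r, and the exponent splits as (r^2 + r)/2 = r +
      r(r-1)/2.\<close>
    have "(y\<^sup>2 / (a * b)) ^ r * q ^ ((r\<^sup>2 + r) div 2) = x ^ r * alpha y q r"
      unfolding choose_two_Suc_eq[symmetric] x_def
      by (simp add: power_add power_divide power_mult_distrib power2_eq_square)
    then show "lhs_term q y a b r = qpoch a q r * qpoch b q r /
      (qpoch (b * x) q r * qpoch (a * x) q r) * x ^ r * alpha y q r"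
      unfolding lhs_term_def x(3,4) by (simp add: mult.assoc)
  qed
  have R: "rhs_term q y a b =
      (\<lambda>n. qpoch a q n * qpoch b q n * x ^ n * bailey_beta y q (alpha y q) n)"
    unfolding rhs_term_def bailey_beta_alpha[OF assms(2) q0 y] x_def
    by (rule ext) (simp only: times_divide_eq_left times_divide_eq_right mult_ac)
  note bailey = bailey_lemma[OF assms(2) x(1,2) yq ab summable_alpha[OF assms(2), of y]]
  show ?thesis
    unfolding L R x_def[symmetric] x(3,4)[symmetric] by (intro conjI bailey)
qed

end
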